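(* Let $G=(V,E)$ be a finite graph and let $k,m$ be positive integers such that $km$ divides $|V|$. Suppose that every graph obtained from $G$ by adding to it (the edges of) a union of pairwise vertex-disjoint cliques on $k$ vertices each (with vertices in $V$) has choice number $k$. Then every graph obtained from $G$ by adding to it a union of pairwise vertex-disjoint cliques on $km$ vertices each (with vertices in $V$) has choice number $km$.
   Context: The choice number $ch(H)$ of a graph $H$ is the minimum $n$ such that for every assignment of sets $S(v)$ with $|S(v)|=n$ to the vertices there is a proper vertex coloring assigning each $v$ a color from $S(v)$. *)

theory Defs
  imports "HOL-Library.Ramsey" "HOL-Library.Disjoint_Sets"
begin

definition simple_graph :: "'a set \<Rightarrow> 'a set set \<Rightarrow> bool" where
  "simple_graph V E \<longleftrightarrow> E \<subseteq> [V]\<^bsup>2\<^esup>"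

definition proper_coloring :: "'a set \<Rightarrow> 'a set set \<Rightarrow> ('a \<Rightarrow> 'c) \<Rightarrow> bool" where
  "proper_coloring V E c \<longleftrightarrow> (\<forall>u\<in>V. \<forall>v\<in>V. {u, v} \<in> E \<longrightarrow> c u \<noteq> c v)"

(* Colors are natural numbers.  This is no restriction: the lists on a finite graph involve
   finitely many colors, which can be renamed.  Finiteness of S v is explicit because
   card is 0 on infinite sets. *)
definition choosable :: "'a set \<Rightarrow> 'a set set \<Rightarrow> nat \<Rightarrow> bool" where
  "choosable V E n \<longleftrightarrow>
    (\<forall>S :: 'a \<Rightarrow> nat set.
       (\<forall>v\<in>V. finite (S v) \<and> card (S v) = n) \<longrightarrow>
       (\<exists>c. proper_coloring V E c \<and> (\<forall>v\<in>V. c v \<in> S v)))"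

(* The minimum exists for every finite simple graph, which is (card V)-choosable. *)
definition choice_number :: "'a set \<Rightarrow> 'a set set \<Rightarrow> nat" where
  "choice_number V E = (LEAST n. choosable V E n)"

(* Vertex sets of the cliques in a union of pairwise vertex-disjoint k-cliques on vertices in V.
   The union need not cover V, but it has at least one clique: adding nothing would leave
   the graph itself, whose choice number cannot be both k and k * m when m > 1. *)
definition disjoint_cliques :: "'a set \<Rightarrow> nat \<Rightarrow> 'a set set \<Rightarrow> bool" where
  "disjoint_cliques V k \<Q> \<longleftrightarrow> \<Q> \<noteq> {} \<and> \<Q> \<subseteq> [V]\<^bsup>k\<^esup> \<and> disjoint \<Q>"

definition add_cliques :: "'a set set \<Rightarrow> 'a set set \<Rightarrow> 'a set set" where
  "add_cliques E \<Q> = E \<union> (\<Union>Q\<in>\<Q>. [Q]\<^bsup>2\<^esup>)"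

end

(* The lists of a (k * m)-clique K can be cut down to k-element lists so that K splits into m
   blocks of size k with the lists of different blocks disjoint; a coloring of G plus the
   k-cliques on these blocks from the shorter lists is then proper on K.  To split off one block,
   put the colors one at a time into a set C until at least k vertices of K have k list colors
   in C.  Before the last step fewer than k vertices had this property, so some k-set of vertices
   has it and all vertices outside this set have at most k list colors in C.  The lists outside
   the block, with C removed, retain at least k * (m - 1) colors, and one iterates. *)
theory Submission
  imports Defs
begin

section \<open>Splitting a clique and its lists into blocks\<close>

lemma exists_balanced_threshold:
  fixes S :: "'a \<Rightarrow> nat set"
  assumes "finite K" and "k > 0" and "k \<le> card K"
    and S: "\<And>v. v \<in> K \<Longrightarrow> finite (S v) \<and> k \<le> card (S v)"
  obtains X C where "X \<subseteq> K" "card X = k"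
    "\<forall>v\<in>X. k \<le> card (S v \<inter> C)"
    "\<forall>v\<in>K - X. card (S v \<inter> C) \<le> k"
proof -
  \<comment> \<open>Colors enter in their natural order, so the candidates for \<open>C\<close> are
    the initial segments \<open>{..<t}\<close>.\<close>
  define A where "A t = {v \<in> K. k \<le> card (S v \<inter> {..<t})}" for t
  have "finite (\<Union>v\<in>K. S v)"
    using assms by blast
  then obtain b where "(\<Union>v\<in>K. S v) \<subseteq> {..<b}"
    using finite_nat_iff_bounded by blast
  then have "S v \<inter> {..<b} = S v" if "v \<in> K" for v
    using that by blast
  \<comment> \<open>Once the segment contains all list colors, every vertex of \<open>K\<close>
    qualifies; this guarantees that a least threshold exists.\<close>
  then have "A b = K"
    using S by (auto simp: A_def)
  then have ex: "k \<le> card (A b)"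
    using assms by simp
  define t where "t = (LEAST t. k \<le> card (A t))"
  have t: "k \<le> card (A t)"
    unfolding t_def using ex by (rule LeastI)
  \<comment> \<open>As \<open>k\<close> is positive, the threshold is not 0, so there is a stage
    \<open>s\<close> just before it, at which fewer than \<open>k\<close> vertices qualify.\<close>
  have "A 0 = {}"
    using \<open>k > 0\<close> by (simp add: A_def)
  then obtain s where s: "t = Suc s"
    using t \<open>k > 0\<close> by (cases t) auto
  have less: "card (A s) < k"
    using not_less_Least[of s "\<lambda>t. k \<le> card (A t)"] s unfolding t_def by simp
  \<comment> \<open>Only the color \<open>s\<close> is added between the two stages. Hence a count
    below \<open>k\<close> at stage \<open>s\<close> is at most \<open>k\<close> at stage
    \<open>t\<close>.\<close>
  have step: "card (S v \<inter> {..<s}) \<le> card (S v \<inter> {..<t})"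
    "card (S v \<inter> {..<t}) \<le> Suc (card (S v \<inter> {..<s}))" for v
  proof -
    show "card (S v \<inter> {..<s}) \<le> card (S v \<inter> {..<t})"
      using s by (intro card_mono) auto
    have "card (S v \<inter> {..<t}) \<le> card (insert s (S v \<inter> {..<s}))"
      using s by (intro card_mono) auto
    then show "card (S v \<inter> {..<t}) \<le> Suc (card (S v \<inter> {..<s}))"
      by simp
  qed
  have "A s \<subseteq> A t"
    using order_trans[OF _ step(1)] by (auto simp: A_def)
  moreover have "finite (A t)"
    using assms by (simp add: A_def)
  \<comment> \<open>Being inside \<open>A t\<close> gives the vertices of \<open>X\<close> enough
    colors; containing \<open>A s\<close> ensures that all others had fewer than \<open>k\<close> at
    stage \<open>s\<close>.\<close>
  ultimately obtain X where X: "A s \<subseteq> X" "X \<subseteq> A t" "card X = k"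
    using exists_subset_between[of "A s" k "A t"] less t by auto
  show thesis
  proof (rule that[of X "{..<t}"])
    show "\<forall>v\<in>K - X. card (S v \<inter> {..<t}) \<le> k"
    proof
      fix v assume "v \<in> K - X"
      then have "card (S v \<inter> {..<s}) < k"
        using X(1) by (auto simp: A_def)
      then show "card (S v \<inter> {..<t}) \<le> k"
        using step(2)[of v] by simp
    qed
  qed (use X in \<open>auto simp: A_def\<close>)
qed

text \<open>The last conjunct has the form in which the final coloring uses it: two distinct
  vertices get different colors either through an edge inside a block or through disjoint
  lists.\<close>

definition list_splitting ::
  "nat \<Rightarrow> 'a set \<Rightarrow> ('a \<Rightarrow> 'c set) \<Rightarrow> 'a set set \<Rightarrow> ('a \<Rightarrow> 'c set) \<Rightarrow> bool" where
  "list_splitting k K S \<P> T \<longleftrightarrow>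
     \<Union>\<P> = K \<and> disjoint \<P> \<and> (\<forall>X\<in>\<P>. card X = k) \<and>
     (\<forall>v\<in>K. T v \<subseteq> S v \<and> card (T v) = k) \<and>
     (\<forall>u\<in>K. \<forall>v\<in>K. (\<exists>X\<in>\<P>. u \<in> X \<and> v \<in> X) \<or> T u \<inter> T v = {})"

text \<open>Induction on \<open>m\<close>, one block at a time. The list sizes are only bounded
  below because removing \<open>C\<close> may leave lists of unequal sizes.\<close>

lemma split_lists:
  fixes S :: "'a \<Rightarrow> nat set"
  assumes "finite K" and "k > 0" and "card K = k * m"
    and "\<And>v. v \<in> K \<Longrightarrow> finite (S v) \<and> k * m \<le> card (S v)"
  shows "\<exists>\<P> T. list_splitting k K S \<P> T"
  using assms
proof (induction m arbitrary: K S)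
  case 0
  then have "K = {}"
    by simp
  then show ?case
    by (intro exI[of _ "{}"] exI[of _ S]) (simp add: list_splitting_def)
next
  case (Suc m)
  have "k \<le> card K"
    using Suc.prems(3) by simp
  moreover have "finite (S v) \<and> k \<le> card (S v)" if "v \<in> K" for v
    using Suc.prems(4)[OF that] by simp
  ultimately obtain X C where X: "X \<subseteq> K" "card X = k"
    and inside: "\<forall>v\<in>X. k \<le> card (S v \<inter> C)"
    and outside: "\<forall>v\<in>K - X. card (S v \<inter> C) \<le> k"
    by (rule exists_balanced_threshold[OF \<open>finite K\<close> \<open>k > 0\<close>, of S])
  have "finite X"
    using X \<open>finite K\<close> finite_subset by blast
  then have "card (K - X) = k * m"
    using X Suc.prems by (simp add: card_Diff_subset)
  moreover have "finite (S v - C) \<and> k * m \<le> card (S v - C)" if "v \<in> K - X" for v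
  proof -
    have "card (S v) = card (S v \<inter> C) + card (S v - C)"
      using that Suc.prems(4)[of v] card_Int_Diff by blast
    then show ?thesis
      using bspec[OF outside that] Suc.prems(4)[of v] that by auto
  qed
  ultimately obtain \<P> T where split: "list_splitting k (K - X) (\<lambda>v. S v - C) \<P> T"
    using Suc.IH[of "K - X" "\<lambda>v. S v - C"] Suc.prems(1,2) by blast
  then have P: "\<Union>\<P> = K - X" "disjoint \<P>" "\<forall>Y\<in>\<P>. card Y = k"
    and T: "\<forall>v\<in>K - X. T v \<subseteq> S v - C \<and> card (T v) = k"
    and PT: "\<forall>u\<in>K - X. \<forall>v\<in>K - X. (\<exists>Y\<in>\<P>. u \<in> Y \<and> v \<in> Y) \<or> T u \<inter> T v = {}"
    unfolding list_splitting_def by simp_all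
  \<comment> \<open>The lists on \<open>X\<close> are cut down inside \<open>C\<close>, while those
    from the induction hypothesis avoid \<open>C\<close>; so \<open>C\<close> separates the new
    block from the others.\<close>
  have "\<forall>v\<in>X. \<exists>U. U \<subseteq> S v \<inter> C \<and> card U = k"
    using inside obtain_subset_with_card_n by metis
  then obtain U where U: "\<forall>v\<in>X. U v \<subseteq> S v \<inter> C \<and> card (U v) = k"
    by metis
  show ?case
    unfolding list_splitting_def
  proof (intro exI conjI)
    let ?T = "\<lambda>v. if v \<in> X then U v else T v"
    show "\<Union>(insert X \<P>) = K"
      using P X by auto
    show "disjoint (insert X \<P>)"
      using P by (intro pairwise_insert[THEN iffD2]) (auto simp: disjnt_def)
    show "\<forall>Y\<in>insert X \<P>. card Y = k"
      using P X by auto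
    show "\<forall>v\<in>K. ?T v \<subseteq> S v \<and> card (?T v) = k"
      using U T by auto
    show "\<forall>u\<in>K. \<forall>v\<in>K. (\<exists>Y\<in>insert X \<P>. u \<in> Y \<and> v \<in> Y) \<or> ?T u \<inter> ?T v = {}"
    proof (intro ballI)
      fix u v assume uv: "u \<in> K" "v \<in> K"
      have in_C: "?T w \<subseteq> C" if "w \<in> X" for w
        using U that by auto
      have out_C: "?T w \<inter> C = {}" if "w \<in> K - X" for w
        using T that by auto
      consider "u \<in> X" "v \<in> X" | "u \<in> X" "v \<notin> X" | "u \<notin> X" "v \<in> X" | "u \<notin> X" "v \<notin> X"
        by blast
      then show "(\<exists>Y\<in>insert X \<P>. u \<in> Y \<and> v \<in> Y) \<or> ?T u \<inter> ?T v = {}"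
      proof cases
        case 1
        then show ?thesis
          by simp
      next
        case 2
        then have "?T u \<inter> ?T v = {}"
          using in_C[of u] out_C[of v] uv by (simp only: if_True if_False) blast
        then show ?thesis ..
      next
        case 3
        then have "?T u \<inter> ?T v = {}"
          using in_C[of v] out_C[of u] uv by (simp only: if_True if_False) blast
        then show ?thesis ..
      next
        case 4
        then show ?thesis
          using PT uv by simp
      qed
    qed
  qed
qed

section \<open>Bounds on list sizes and the choice number\<close>

lemma exists_injective_choice:
  assumes "finite V" and "\<And>v. v \<in> V \<Longrightarrow> card V \<le> card (S v)"
  shows "\<exists>c. inj_on c V \<and> (\<forall>v\<in>V. c v \<in> S v)"
  using assms
proof (induction V rule: finite_induct)
  case empty
  then show ?case by simp
next
  case (insert x V)
  have "card V \<le> card (S v)" if "v \<in> V" for v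
    using insert.prems[of v] insert.hyps that by simp
  then obtain c where c: "inj_on c V" "\<forall>v\<in>V. c v \<in> S v"
    using insert.IH by blast
  \<comment> \<open>Greedy step: the colors already used cannot exhaust the list of
    \<open>x\<close>.\<close>
  have "card (c ` V) < card (S x)"
    using insert.prems[of x] insert.hyps card_image_le[of V c] by simp
  then obtain y where "y \<in> S x" "y \<notin> c ` V"
    by (meson card_mono finite_imageI insert.hyps(1) not_le subsetI)
  then show ?case
    using c insert.hyps by (intro exI[of _ "c(x := y)"]) (auto simp: inj_on_def)
qed

text \<open>An injective choice of colors is proper on any simple graph. This supplies the witness
  that makes the \<open>LEAST\<close> in \<open>choice_number\<close> an attained minimum.\<close>

lemma choosable_card:
  assumes "finite V" and "simple_graph V E"
  shows "choosable V E (card V)"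
  unfolding choosable_def
proof (intro allI impI)
  fix S :: "'a \<Rightarrow> nat set"
  assume "\<forall>v\<in>V. finite (S v) \<and> card (S v) = card V"
  then obtain c where c: "inj_on c V" "\<forall>v\<in>V. c v \<in> S v"
    using exists_injective_choice[OF \<open>finite V\<close>, of S] by auto
  \<comment> \<open>A loop \<open>{u, u}\<close> in \<open>E\<close> would rule out every proper
    coloring; edges of a simple graph have two distinct ends.\<close>
  have "{u, v} \<in> E \<Longrightarrow> u \<noteq> v" for u v
    using assms(2) by (auto simp: simple_graph_def nsets_def)
  then have "proper_coloring V E c"
    using c(1) by (auto simp: proper_coloring_def inj_on_def)
  with c show "\<exists>c. proper_coloring V E c \<and> (\<forall>v\<in>V. c v \<in> S v)"
    by blast
qed

lemma choosable_choice_number: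
  assumes "finite V" and "simple_graph V E"
  shows "choosable V E (choice_number V E)"
  unfolding choice_number_def using choosable_card[OF assms] by (rule LeastI)

lemma simple_graph_add_cliques:
  assumes "simple_graph V E" and "disjoint_cliques V k \<Q>"
  shows "simple_graph V (add_cliques E \<Q>)"
proof -
  have "[Q]\<^bsup>2\<^esup> \<subseteq> [V]\<^bsup>2\<^esup>" if "Q \<in> \<Q>" for Q
    using assms(2) that by (intro nsets_mono) (auto simp: disjoint_cliques_def nsets_def)
  then show ?thesis
    using assms(1) by (auto simp: simple_graph_def add_cliques_def)
qed

text \<open>With the same list \<open>{..<n}\<close> at every vertex, a proper coloring is injective
  on the clique. This yields the lower bound for the choice number.\<close>

lemma clique_le_choosable:
  assumes "choosable V E n" and "Q \<subseteq> V" and "[Q]\<^bsup>2\<^esup> \<subseteq> E"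
  shows "card Q \<le> n"
proof -
  obtain c where c: "proper_coloring V E c" "\<forall>v\<in>V. c v \<in> {..<n}"
    using assms(1)[unfolded choosable_def, rule_format, of "\<lambda>_. {..<n}"] by auto
  have "inj_on c Q"
  proof (rule inj_onI, rule ccontr)
    fix u v assume uv: "u \<in> Q" "v \<in> Q" "c u = c v" "u \<noteq> v"
    then have "{u, v} \<in> [Q]\<^bsup>2\<^esup>"
      by (simp add: nsets_def)
    then have "{u, v} \<in> E"
      using assms(3) by blast
    moreover have "u \<in> V" "v \<in> V"
      using uv assms(2) by blast+
    ultimately show False
      using c(1) \<open>c u = c v\<close> unfolding proper_coloring_def by blast
  qed
  then show ?thesis
    using card_inj_on_le[of c Q "{..<n}"] c(2) assms(2) by fastforce
qed

section \<open>Passing from k-cliques to km-cliques\<close>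

lemma choosable_add_larger_cliques:
  assumes "finite V" and "k > 0" and "m > 0"
    and ch: "\<And>\<R>. disjoint_cliques V k \<R> \<Longrightarrow> choosable V (add_cliques E \<R>) k"
    and Q: "disjoint_cliques V (k * m) \<Q>"
  shows "choosable V (add_cliques E \<Q>) (k * m)"
  unfolding choosable_def
proof (intro allI impI)
  fix S :: "'a \<Rightarrow> nat set"
  assume S: "\<forall>v\<in>V. finite (S v) \<and> card (S v) = k * m"
  have QV: "Q \<subseteq> V" "finite Q" "card Q = k * m" if "Q \<in> \<Q>" for Q
    using Q that by (auto simp: disjoint_cliques_def nsets_def)
  have disj: "Q = Q'" if "Q \<in> \<Q>" "Q' \<in> \<Q>" "v \<in> Q" "v \<in> Q'" for Q Q' v
    using Q that by (auto simp: disjoint_cliques_def disjoint_def)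
  have "\<exists>\<P> T. list_splitting k Q S \<P> T" if "Q \<in> \<Q>" for Q
  proof (rule split_lists)
    show "finite (S v) \<and> k * m \<le> card (S v)" if "v \<in> Q" for v
      using S QV(1)[OF \<open>Q \<in> \<Q>\<close>] that by auto
  qed (use QV[OF that] \<open>k > 0\<close> in auto)
  then obtain \<P> T where splits: "\<And>Q. Q \<in> \<Q> \<Longrightarrow> list_splitting k Q S (\<P> Q) (T Q)"
    by metis
  then have P: "\<Union>(\<P> Q) = Q" "disjoint (\<P> Q)" "\<forall>X\<in>\<P> Q. card X = k"
    and T: "\<forall>v\<in>Q. T Q v \<subseteq> S v \<and> card (T Q v) = k"
    and PT: "\<forall>u\<in>Q. \<forall>v\<in>Q. (\<exists>X\<in>\<P> Q. u \<in> X \<and> v \<in> X) \<or> T Q u \<inter> T Q v = {}"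
    if "Q \<in> \<Q>" for Q
    using splits[OF that] unfolding list_splitting_def by simp_all
  \<comment> \<open>The short lists of the separate cliques are glued into one assignment. This is
    consistent because a vertex lies in at most one clique; a vertex in none gets any
    \<open>k\<close> colors of its list, which has \<open>k * m\<close> \<ge> \<open>k\<close> of
    them.\<close>
  have "\<forall>v\<in>V. \<exists>L. L \<subseteq> S v \<and> card L = k \<and> (\<forall>Q\<in>\<Q>. v \<in> Q \<longrightarrow> L = T Q v)"
  proof
    fix v assume "v \<in> V"
    show "\<exists>L. L \<subseteq> S v \<and> card L = k \<and> (\<forall>Q\<in>\<Q>. v \<in> Q \<longrightarrow> L = T Q v)"
    proof (cases "\<exists>Q\<in>\<Q>. v \<in> Q")
      case True
      then obtain Q where "Q \<in> \<Q>" "v \<in> Q"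
        by blast
      then have "Q' = Q" if "Q' \<in> \<Q>" "v \<in> Q'" for Q'
        using disj that by blast
      then show ?thesis
        using T[OF \<open>Q \<in> \<Q>\<close>] \<open>v \<in> Q\<close> by (intro exI[of _ "T Q v"]) auto
    next
      case False
      have "k \<le> card (S v)"
        using S \<open>v \<in> V\<close> \<open>m > 0\<close> by simp
      then obtain L where "L \<subseteq> S v" "card L = k"
        using obtain_subset_with_card_n by metis
      then show ?thesis
        using False by blast
    qed
  qed
  then obtain L where L: "\<forall>v\<in>V. L v \<subseteq> S v \<and> card (L v) = k \<and> (\<forall>Q\<in>\<Q>. v \<in> Q \<longrightarrow> L v = T Q v)"
    by metis
  define \<R> where "\<R> = (\<Union>Q\<in>\<Q>. \<P> Q)"
  have "disjoint_cliques V k \<R>"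
    unfolding disjoint_cliques_def
  proof (intro conjI)
    obtain Q where "Q \<in> \<Q>"
      using Q by (auto simp: disjoint_cliques_def)
    \<comment> \<open>A clique has \<open>k * m\<close> > 0 vertices, so its splitting has at least
      one block.\<close>
    have "Q \<noteq> {}"
      using QV[OF \<open>Q \<in> \<Q>\<close>] \<open>k > 0\<close> \<open>m > 0\<close> by auto
    then show "\<R> \<noteq> {}"
      using P(1)[OF \<open>Q \<in> \<Q>\<close>] \<open>Q \<in> \<Q>\<close> unfolding \<R>_def by blast
    show "\<R> \<subseteq> [V]\<^bsup>k\<^esup>"
    proof
      fix X assume "X \<in> \<R>"
      then obtain Q where "Q \<in> \<Q>" "X \<in> \<P> Q"
        by (auto simp: \<R>_def)
      then have "X \<subseteq> V" "card X = k"
        using P(1,3)[of Q] QV(1)[of Q] by auto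
      then show "X \<in> [V]\<^bsup>k\<^esup>"
        using \<open>finite V\<close> finite_subset by (auto simp: nsets_def)
    qed
    show "disjoint \<R>"
    proof (rule disjointI)
      fix X Y assume "X \<in> \<R>" "Y \<in> \<R>" "X \<noteq> Y"
      then obtain Q Q' where QQ: "Q \<in> \<Q>" "X \<in> \<P> Q" "Q' \<in> \<Q>" "Y \<in> \<P> Q'"
        by (auto simp: \<R>_def)
      show "X \<inter> Y = {}"
      \<comment> \<open>Blocks of one clique are disjoint by the splitting, blocks of different
        cliques because the cliques are.\<close>
      proof (cases "Q = Q'")
        case True
        then show ?thesis
          using P(2)[OF \<open>Q \<in> \<Q>\<close>] QQ \<open>X \<noteq> Y\<close> by (auto simp: disjoint_def)
      next
        case False
        have "X \<subseteq> Q" "Y \<subseteq> Q'"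
          using P(1)[OF QQ(1)] P(1)[OF QQ(3)] QQ by auto
        then show ?thesis
          using disj QQ False by blast
      qed
    qed
  qed
  moreover have "\<forall>v\<in>V. finite (L v) \<and> card (L v) = k"
    using L S finite_subset by metis
  ultimately obtain c where c: "proper_coloring V (add_cliques E \<R>) c" "\<forall>v\<in>V. c v \<in> L v"
    using ch unfolding choosable_def by blast
  have "c u \<noteq> c v" if uv: "u \<in> V" "v \<in> V" "{u, v} \<in> add_cliques E \<Q>" for u v
  \<comment> \<open>Edges of \<open>E\<close> and edges inside a block survive in the graph colored
    by \<open>c\<close>. Any other edge joins two blocks of one clique, where the lists are
    disjoint.\<close>
  proof (cases "{u, v} \<in> add_cliques E \<R>")
    case True
    then show ?thesis
      using c(1) uv by (simp add: proper_coloring_def)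
  next
    case False
    then obtain Q where "Q \<in> \<Q>" and uvQ: "{u, v} \<in> [Q]\<^bsup>2\<^esup>"
      using uv by (auto simp: add_cliques_def)
    then have mem: "u \<in> Q" "v \<in> Q"
      by (auto simp: nsets_def)
    have "\<not> (\<exists>X\<in>\<P> Q. u \<in> X \<and> v \<in> X)"
      using False uvQ \<open>Q \<in> \<Q>\<close> by (auto simp: add_cliques_def \<R>_def nsets_def)
    then have "T Q u \<inter> T Q v = {}"
      using PT[OF \<open>Q \<in> \<Q>\<close>] mem by blast
    moreover have "c u \<in> T Q u" "c v \<in> T Q v"
      using c(2) L uv mem \<open>Q \<in> \<Q>\<close> by auto
    ultimately show ?thesis
      by auto
  qed
  then have "proper_coloring V (add_cliques E \<Q>) c"
    by (simp add: proper_coloring_def)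
  moreover have "\<forall>v\<in>V. c v \<in> S v"
    using c(2) L by blast
  ultimately show "\<exists>c. proper_coloring V (add_cliques E \<Q>) c \<and> (\<forall>v\<in>V. c v \<in> S v)"
    by blast
qed

theorem theorem7p3:
  fixes V :: "'a set" and E :: "'a set set" and k m :: nat
  assumes "finite V" and "simple_graph V E"
    and "k > 0" and "m > 0"
    and "k * m dvd card V"
    and "\<And>\<Q>. disjoint_cliques V k \<Q> \<Longrightarrow> choice_number V (add_cliques E \<Q>) = k"
  shows "\<forall>\<Q>. disjoint_cliques V (k * m) \<Q> \<longrightarrow>
           choice_number V (add_cliques E \<Q>) = k * m"
proof (intro allI impI)
  fix \<Q> assume Q: "disjoint_cliques V (k * m) \<Q>"
  \<comment> \<open>A choice number of \<open>k\<close> yields choosability from lists of size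
    \<open>k\<close> because the minimum is attained.\<close>
  have "choosable V (add_cliques E \<R>) k" if "disjoint_cliques V k \<R>" for \<R>
    using choosable_choice_number[OF \<open>finite V\<close> simple_graph_add_cliques[OF assms(2) that]]
      assms(6)[OF that] by simp
  then have "choosable V (add_cliques E \<Q>) (k * m)"
    using choosable_add_larger_cliques[OF assms(1,3,4) _ Q] by blast
  \<comment> \<open>The lower bound comes from any single added clique; one exists since
    \<open>disjoint_cliques\<close> excludes the empty family.\<close>
  moreover have "k * m \<le> n" if "choosable V (add_cliques E \<Q>) n" for n
  proof -
    obtain Q where "Q \<in> \<Q>" "Q \<subseteq> V" "card Q = k * m"
      using Q by (auto simp: disjoint_cliques_def nsets_def)
    then show ?thesis
      using clique_le_choosable[OF that \<open>Q \<subseteq> V\<close>] by (auto simp: add_cliques_def)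
  qed
  ultimately show "choice_number V (add_cliques E \<Q>) = k * m"
    unfolding choice_number_def by (rule Least_equality)
qed

end
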